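(* For $n\ge 0$, $k\ge 0$ let $\bar b_{n,k}$ be the number of connected bipartite graphs of order $n$ and size $k$ on the vertex set $[n]=\{1,\dots,n\}$ (with $\bar b_{0,k}=0$), and let $$\tilde{\mathcal B}(x,y,z)=\sum_{n\ge 1,\,k\ge 0}\bar b_{n,k}\,\frac{1}{n!}\,x^n y^k z_n ,$$ a formal series in $x$, $y$ and infinitely many variables $z_1,z_2,\dots$. Let $\omega=(1,1,1,\dots)$. Then the number of bipartite graphs of given order, size and number of connected components is generated by $\tau_\omega(\exp\tilde{\mathcal B}(x,y,z))$. That is, if $$\tau_\omega(\exp\tilde{\mathcal B})=\sum_{n,k,\nu} b_{n,k,\nu}\,\frac{1}{n!}\,x^n y^k z^\nu,$$ then $b_{n,k,\nu}$ is precisely the number of bipartite graphs on $[n]$ of order $n$ and size $k$ with $\nu$ connected components.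
   Context: All graphs are finite, simple and labeled. The order of a graph is its number of vertices and its size is its number of edges. A graph is bipartite if its vertices can be colored with two colors so that no two adjacent vertices have the same color (a single vertex is a connected bipartite graph). The graph with no vertices is counted once, with $0$ components, corresponding to the constant term $1$. For $\omega=(\omega_1,\omega_2,\dots)\in\mathbb Q^\infty$, $\tau_\omega$ is the ring homomorphism determined by $\prod_i z_i^{\alpha_i}\mapsto z^{\sum_i\omega_i\alpha_i}$; it fixes $x$ and $y$ and is applied coefficientwise to formal power series in $x$. For $\omega=(1,1,1,\dots)$ it sends every $z_i$ to the single variable $z$. *)

theory Defs
  imports "HOL-Library.Poly_Mapping" "HOL-Computational_Algebra.Formal_Power_Series"
begin

section \<open>Finite simple labeled graphs\<close>

text \<open>
  A simple graph on the vertex set \<open>V\<close> is given by its set of edges, a set of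
  two-element subsets of \<open>V\<close>. Its order is \<open>card V\<close> and its size is \<open>card E\<close>.
\<close>

definition simple_graphs :: "'a set \<Rightarrow> 'a set set set" where
  "simple_graphs V = Pow {e. e \<subseteq> V \<and> card e = 2}"

definition bipartite :: "'a set \<Rightarrow> 'a set set \<Rightarrow> bool" where
  "bipartite V E \<longleftrightarrow> (\<exists>c :: 'a \<Rightarrow> bool. \<forall>u\<in>V. \<forall>v\<in>V. {u, v} \<in> E \<longrightarrow> c u \<noteq> c v)"

text \<open>Two vertices are related iff there is a (possibly trivial) path between them.\<close>

definition reachability :: "'a set \<Rightarrow> 'a set set \<Rightarrow> ('a \<times> 'a) set" where
  "reachability V E = {(u, v). u \<in> V \<and> v \<in> V \<and> {u, v} \<in> E}\<^sup>* \<inter> V \<times> V"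

text \<open>Connected graphs are nonempty; the graph without vertices has no components.\<close>

definition connected_graph :: "'a set \<Rightarrow> 'a set set \<Rightarrow> bool" where
  "connected_graph V E \<longleftrightarrow> V \<noteq> {} \<and> (\<forall>u\<in>V. \<forall>v\<in>V. (u, v) \<in> reachability V E)"

definition components_of :: "'a set \<Rightarrow> 'a set set \<Rightarrow> 'a set set" where
  "components_of V E = V // reachability V E"

definition num_connected_bipartite :: "nat \<Rightarrow> nat \<Rightarrow> nat" where
  "num_connected_bipartite n k =
     card {E \<in> simple_graphs {1..n}. connected_graph {1..n} E \<and> bipartite {1..n} E \<and> card E = k}"

definition num_bipartite :: "nat \<Rightarrow> nat \<Rightarrow> nat \<Rightarrow> nat" where
  "num_bipartite n k \<nu> =
     card {E \<in> simple_graphs {1..n}.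
             bipartite {1..n} E \<and> card E = k \<and> card (components_of {1..n} E) = \<nu>}"


section \<open>Formal series in \<open>x\<close>, \<open>y\<close> and the variables \<open>z\<^sub>i\<close>\<close>

text \<open>
  \<^item> \<open>rat fps\<close>: power series in \<open>y\<close>.
  \<^item> \<open>(nat \<Rightarrow>\<^sub>0 nat) \<Rightarrow>\<^sub>0 rat fps\<close>: polynomials in \<open>z\<^sub>1, z\<^sub>2, \<dots>\<close> over these; an exponent
    \<open>\<alpha>\<close> stands for the monomial \<open>\<Prod>\<^sub>i z\<^sub>i\<^bsup>\<alpha>\<^sub>i\<^esup>\<close>. The index \<open>0\<close> is never used.
  \<^item> \<open>rat \<Rightarrow>\<^sub>0 rat fps\<close>: finite sums of rational powers of the single variable \<open>z\<close>.
  The outer \<open>fps\<close> layer is the variable \<open>x\<close>.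
\<close>

type_synonym z_poly = "(nat \<Rightarrow>\<^sub>0 nat) \<Rightarrow>\<^sub>0 rat fps"
type_synonym z_powers = "rat \<Rightarrow>\<^sub>0 rat fps"

definition B_series :: "z_poly fps" where
  "B_series = Abs_fps (\<lambda>n. if n = 0 then 0 else
     Poly_Mapping.single (Poly_Mapping.single n 1)
       (Abs_fps (\<lambda>k. of_nat (num_connected_bipartite n k) / fact n)))"

text \<open>
  The composition of \<open>\<Sum>\<^sub>m t\<^sup>m / m!\<close> with \<open>F\<close>, meaningful for \<open>F\<close> without constant term
  in \<open>x\<close>. The library's \<open>fps_exp\<close> needs a coefficient field, which \<open>z_poly\<close> is not.
\<close>

definition exp_series :: "z_poly fps \<Rightarrow> z_poly fps" where
  "exp_series F = fps_compose (Abs_fps (\<lambda>m. Poly_Mapping.single 0 (fps_const (1 / fact m)))) F"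

definition tau_coeff :: "(nat \<Rightarrow> rat) \<Rightarrow> z_poly \<Rightarrow> z_powers" where
  "tau_coeff \<omega> p =
     (\<Sum>\<alpha>\<in>Poly_Mapping.keys p.
        Poly_Mapping.single (\<Sum>i\<in>Poly_Mapping.keys \<alpha>. \<omega> i * of_nat (Poly_Mapping.lookup \<alpha> i))
          (Poly_Mapping.lookup p \<alpha>))"

definition tau :: "(nat \<Rightarrow> rat) \<Rightarrow> z_poly fps \<Rightarrow> z_powers fps" where
  "tau \<omega> F = Abs_fps (\<lambda>n. tau_coeff \<omega> (fps_nth F n))"

text \<open>\<open>xyz_coeff F n k q\<close> is the coefficient of \<open>x\<^sup>n y\<^sup>k z\<^sup>q\<close>.\<close>

definition xyz_coeff :: "z_powers fps \<Rightarrow> nat \<Rightarrow> nat \<Rightarrow> rat \<Rightarrow> rat" where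
  "xyz_coeff F n k q = fps_nth (Poly_Mapping.lookup (fps_nth F n) q) k"

text \<open>
  \<open>F = \<Sum>\<^sub>n\<^sub>,\<^sub>k\<^sub>,\<^sub>\<nu> b n k \<nu> / n! x\<^sup>n y\<^sup>k z\<^sup>\<nu>\<close> with \<open>n\<close>, \<open>k\<close>, \<open>\<nu>\<close> ranging over the natural numbers; in
  particular no other power of \<open>z\<close> occurs in \<open>F\<close>.
\<close>

definition has_expansion :: "z_powers fps \<Rightarrow> (nat \<Rightarrow> nat \<Rightarrow> nat \<Rightarrow> rat) \<Rightarrow> bool" where
  "has_expansion F b \<longleftrightarrow>
     (\<forall>n k \<nu>. xyz_coeff F n k (of_nat \<nu>) = b n k \<nu> / fact n) \<and>
     (\<forall>n k q. q \<notin> \<nat> \<longrightarrow> xyz_coeff F n k q = 0)"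


subsection \<open>\<open>tau_coeff \<omega>\<close> is the homomorphism determined by its values on monomials\<close>

lemma tau_coeff_superset:
  assumes "finite A" "Poly_Mapping.keys p \<subseteq> A"
  shows "tau_coeff \<omega> p =
     (\<Sum>\<alpha>\<in>A. Poly_Mapping.single (\<Sum>i\<in>Poly_Mapping.keys \<alpha>. \<omega> i * of_nat (Poly_Mapping.lookup \<alpha> i))
          (Poly_Mapping.lookup p \<alpha>))"
  unfolding tau_coeff_def using assms
  by (intro sum.mono_neutral_left) (auto simp: in_keys_iff)

lemma tau_coeff_single:
  "tau_coeff \<omega> (Poly_Mapping.single \<alpha> c) =
     Poly_Mapping.single (\<Sum>i\<in>Poly_Mapping.keys \<alpha>. \<omega> i * of_nat (Poly_Mapping.lookup \<alpha> i)) c"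
  by (subst tau_coeff_superset[of "{\<alpha>}"]) auto

lemma tau_coeff_zero: "tau_coeff \<omega> 0 = 0"
  by (simp add: tau_coeff_def)

lemma tau_coeff_one: "tau_coeff \<omega> 1 = 1"
  unfolding single_one[symmetric] tau_coeff_single by simp

lemma tau_coeff_add: "tau_coeff \<omega> (p + q) = tau_coeff \<omega> p + tau_coeff \<omega> q"
proof -
  let ?A = "Poly_Mapping.keys p \<union> Poly_Mapping.keys q"
  have "Poly_Mapping.keys (p + q) \<subseteq> ?A" by (rule Poly_Mapping.keys_add)
  then show ?thesis
    by (simp add: tau_coeff_superset[of ?A] lookup_add single_add sum.distrib)
qed

lemma tau_coeff_sum: "tau_coeff \<omega> (\<Sum>i\<in>I. f i) = (\<Sum>i\<in>I. tau_coeff \<omega> (f i))"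
  by (induction I rule: infinite_finite_induct) (auto simp: tau_coeff_zero tau_coeff_add)

lemma weight_add:
  fixes \<omega> :: "nat \<Rightarrow> rat" and \<alpha> \<beta> :: "nat \<Rightarrow>\<^sub>0 nat"
  shows "(\<Sum>i\<in>Poly_Mapping.keys (\<alpha> + \<beta>). \<omega> i * of_nat (Poly_Mapping.lookup (\<alpha> + \<beta>) i)) =
     (\<Sum>i\<in>Poly_Mapping.keys \<alpha>. \<omega> i * of_nat (Poly_Mapping.lookup \<alpha> i)) +
     (\<Sum>i\<in>Poly_Mapping.keys \<beta>. \<omega> i * of_nat (Poly_Mapping.lookup \<beta> i))"
proof -
  let ?A = "Poly_Mapping.keys \<alpha> \<union> Poly_Mapping.keys \<beta>"
  have *: "(\<Sum>i\<in>Poly_Mapping.keys \<gamma>. \<omega> i * of_nat (Poly_Mapping.lookup \<gamma> i)) =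
      (\<Sum>i\<in>?A. \<omega> i * of_nat (Poly_Mapping.lookup \<gamma> i))"
    if "Poly_Mapping.keys \<gamma> \<subseteq> ?A" for \<gamma> :: "nat \<Rightarrow>\<^sub>0 nat"
    using that by (intro sum.mono_neutral_left) (auto simp: in_keys_iff)
  show ?thesis
    unfolding *[OF Poly_Mapping.keys_add] *[OF Un_upper1] *[OF Un_upper2]
    by (simp add: lookup_add sum.distrib distrib_left)
qed

lemma tau_coeff_mult: "tau_coeff \<omega> (p * q) = tau_coeff \<omega> p * tau_coeff \<omega> q"
proof -
  have mono: "tau_coeff \<omega> (Poly_Mapping.single \<alpha> c * Poly_Mapping.single \<beta> d) =
      tau_coeff \<omega> (Poly_Mapping.single \<alpha> c) * tau_coeff \<omega> (Poly_Mapping.single \<beta> d)"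
    for \<alpha> \<beta> c d
    by (simp add: mult_single tau_coeff_single weight_add)
  have decomp: "(\<Sum>\<alpha>\<in>Poly_Mapping.keys r. Poly_Mapping.single \<alpha> (Poly_Mapping.lookup r \<alpha>)) = r"
    for r :: z_poly
    by (rule poly_mapping_eqI) (auto simp: lookup_sum lookup_single when_def in_keys_iff)
  have "tau_coeff \<omega> ((\<Sum>\<alpha>\<in>Poly_Mapping.keys p. Poly_Mapping.single \<alpha> (Poly_Mapping.lookup p \<alpha>)) *
          (\<Sum>\<beta>\<in>Poly_Mapping.keys q. Poly_Mapping.single \<beta> (Poly_Mapping.lookup q \<beta>))) =
        tau_coeff \<omega> (\<Sum>\<alpha>\<in>Poly_Mapping.keys p. Poly_Mapping.single \<alpha> (Poly_Mapping.lookup p \<alpha>)) *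
        tau_coeff \<omega> (\<Sum>\<beta>\<in>Poly_Mapping.keys q. Poly_Mapping.single \<beta> (Poly_Mapping.lookup q \<beta>))"
    by (simp only: sum_product tau_coeff_sum mono)
  then show ?thesis by (simp only: decomp)
qed

end

theory Submission
  imports Defs
begin

text \<open>
  Marking one of the components of a bipartite graph splits it into a connected bipartite graph
  on some \<open>S \<subseteq> V\<close> and a bipartite graph on \<open>V - S\<close> with one component less. Hence the generating
  polynomials \<open>P\<^sub>\<nu>(V)\<close> in \<open>y\<close> of the bipartite graphs with \<open>\<nu>\<close> components satisfy
  \<open>(\<nu> + 1) P\<^sub>\<nu>\<^sub>+\<^sub>1(V) = \<Sum>\<^sub>S C(S) P\<^sub>\<nu>(V - S)\<close>, and since these depend on the cardinalities only, induction
  on \<open>\<nu>\<close> identifies \<open>\<nu>! P\<^sub>\<nu>(n) / n!\<close> with the coefficient of \<open>x\<^sup>n\<close> in the \<open>\<nu>\<close>-th power of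
  \<open>\<Sum>\<^sub>n C(n) x\<^sup>n / n!\<close>. Under \<open>\<tau>\<close>, that power carries exactly \<open>z\<^sup>\<nu>\<close>.
\<close>

section \<open>Components and relabelling\<close>

lemma finite_simple_graphs: "finite V \<Longrightarrow> finite (simple_graphs V)"
  by (simp add: simple_graphs_def)

lemma simple_graphs_subset_Pow: "E \<in> simple_graphs V \<Longrightarrow> E \<subseteq> Pow V"
  by (auto simp: simple_graphs_def)

lemma finite_edges: "finite V \<Longrightarrow> E \<in> simple_graphs V \<Longrightarrow> finite E"
  by (rule finite_subset[OF simple_graphs_subset_Pow]) auto

lemma reachability_refl: "u \<in> V \<Longrightarrow> (u, u) \<in> reachability V E"
  by (simp add: reachability_def)

lemma reachability_subset: "reachability V E \<subseteq> V \<times> V"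
  by (simp add: reachability_def)

lemma equiv_reachability: "equiv V (reachability V E)"
proof (rule equivI)
  have "sym {(u, v). u \<in> V \<and> v \<in> V \<and> {u, v} \<in> E}"
    by (auto simp: sym_def insert_commute)
  then have "sym ({(u, v). u \<in> V \<and> v \<in> V \<and> {u, v} \<in> E}\<^sup>*)"
    by (rule sym_rtrancl)
  then show "sym (reachability V E)"
    by (auto simp: reachability_def sym_def)
  show "trans (reachability V E)"
    by (auto simp: reachability_def trans_def)
  show "refl_on V (reachability V E)"
    by (simp add: refl_on_def reachability_refl)
qed (rule reachability_subset)

section \<open>Paths under enlargement, vertex maps and disjoint union\<close>

lemma reachability_mono:
  assumes "V \<subseteq> W" "E \<subseteq> F"
  shows "reachability V E \<subseteq> reachability W F"
proof -
  have "{(u, v). u \<in> V \<and> v \<in> V \<and> {u, v} \<in> E}\<^sup>* \<subseteq> {(u, v). u \<in> W \<and> v \<in> W \<and> {u, v} \<in> F}\<^sup>*"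
    using assms by (intro rtrancl_mono) auto
  then show ?thesis
    using assms by (auto simp: reachability_def)
qed

lemma reachability_image:
  assumes "(u, v) \<in> reachability V E"
  shows "(f u, f v) \<in> reachability (f ` V) ((`) f ` E)"
proof -
  have "(f u, f v) \<in> {(u, v). u \<in> f ` V \<and> v \<in> f ` V \<and> {u, v} \<in> (`) f ` E}\<^sup>*"
    if "(u, v) \<in> {(u, v). u \<in> V \<and> v \<in> V \<and> {u, v} \<in> E}\<^sup>*"
    using that
  proof (induction rule: rtrancl_induct)
    case (step v w)
    then have "{f v, f w} = f ` {v, w}" "{v, w} \<in> E"
      by auto
    then have "{f v, f w} \<in> (`) f ` E"
      by blast
    with step show ?case
      by (auto intro!: rtrancl_into_rtrancl[OF step.IH])
  qed auto
  with assms show ?thesis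
    by (auto simp: reachability_def)
qed

lemma image_image_cancel:
  assumes "\<And>e. e \<in> E \<Longrightarrow> g ` f ` e = e"
  shows "(`) g ` (`) f ` E = E"
proof (intro equalityI subsetI)
  fix x assume "x \<in> (`) g ` (`) f ` E"
  then obtain e where "e \<in> E" "x = g ` f ` e" by blast
  with assms show "x \<in> E" by metis
next
  fix x assume "x \<in> E"
  with assms show "x \<in> (`) g ` (`) f ` E" by (metis imageI)
qed

text \<open>A path starting in \<open>S\<close> never leaves \<open>S\<close>: every edge lies
  inside \<open>S\<close> or inside \<open>T\<close>, and these are disjoint, so the next edge must
  belong to \<open>E\<close>. The same holds for \<open>T\<close> and \<open>F\<close>.\<close>

lemma reachability_Un:
  assumes "S \<inter> T = {}" "E \<subseteq> Pow S" "F \<subseteq> Pow T"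
  shows "reachability (S \<union> T) (E \<union> F) = reachability S E \<union> reachability T F"
proof (rule subset_antisym)
  have "(u, v) \<in> reachability S E \<union> reachability T F"
    if "(u, v) \<in> {(u, v). u \<in> S \<union> T \<and> v \<in> S \<union> T \<and> {u, v} \<in> E \<union> F}\<^sup>*" "u \<in> S \<union> T" for u v
    using that
  proof (induction rule: rtrancl_induct)
    case base
    then show ?case by (auto intro: reachability_refl)
  next
    case (step v w)
    have *: "(u, w) \<in> reachability V G"
      if "(u, v) \<in> reachability V G" "v \<in> V" "w \<in> V" "{v, w} \<in> G" for V G
      using that unfolding reachability_def by (auto intro: rtrancl_into_rtrancl)
    have "(u, v) \<in> reachability S E \<union> reachability T F"
      using step by blast
    moreover have "{v, w} \<in> E \<or> {v, w} \<in> F"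
      using step by blast
    ultimately show ?case
      using assms *[of S E] *[of T F] reachability_subset[of S E] reachability_subset[of T F]
      by blast
  qed
  then show "reachability (S \<union> T) (E \<union> F) \<subseteq> reachability S E \<union> reachability T F"
    by (auto simp: reachability_def)
  show "reachability S E \<union> reachability T F \<subseteq> reachability (S \<union> T) (E \<union> F)"
    by (intro Un_least reachability_mono) auto
qed

section \<open>Components as equivalence classes\<close>

lemma components_of_Un:
  assumes "S \<inter> T = {}" "E \<subseteq> Pow S" "F \<subseteq> Pow T"
  shows "components_of (S \<union> T) (E \<union> F) = components_of S E \<union> components_of T F"
proof -
  have "reachability (S \<union> T) (E \<union> F) `` {u} = reachability S E `` {u}" if "u \<in> S" for u
    using that assms reachability_subset[of T F] by (auto simp: reachability_Un)
  moreover have "reachability (S \<union> T) (E \<union> F) `` {u} = reachability T F `` {u}" if "u \<in> T" for u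
    using that assms reachability_subset[of S E] by (auto simp: reachability_Un)
  ultimately show ?thesis
    by (auto simp: components_of_def quotient_def)
qed

lemma component_nonempty: "C \<in> components_of V E \<Longrightarrow> C \<noteq> {}"
  using reachability_refl[of _ V E] by (auto simp: components_of_def quotient_def)

lemma component_subset: "C \<in> components_of V E \<Longrightarrow> C \<subseteq> V"
  using reachability_subset[of V E] by (auto simp: components_of_def quotient_def)

lemma finite_components_of: "finite V \<Longrightarrow> finite (components_of V E)"
  by (rule finite_subset[of _ "Pow V"]) (auto dest: component_subset)

text \<open>Classes are nonempty, so the condition \<open>V \<noteq> {}\<close> is built into
  membership. This form lets connectedness be read off a set of components.\<close>

lemma connected_graph_iff: "connected_graph V E \<longleftrightarrow> V \<in> components_of V E"
proof
  assume *: "connected_graph V E"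
  then obtain u where u: "u \<in> V"
    by (auto simp: connected_graph_def)
  with * have "reachability V E `` {u} = V"
    using reachability_subset[of V E] by (auto simp: connected_graph_def)
  with u show "V \<in> components_of V E"
    by (auto simp: components_of_def quotient_def)
next
  assume *: "V \<in> components_of V E"
  then have "(u, v) \<in> reachability V E" if "u \<in> V" "v \<in> V" for u v
    using quotient_eq_iff[OF equiv_reachability, of V V E V u v] that
    by (auto simp: components_of_def)
  then show "connected_graph V E"
    using component_nonempty[OF *] by (auto simp: connected_graph_def)
qed

lemma components_of_connected:
  assumes "connected_graph V E"
  shows "components_of V E = {V}"
proof -
  have V: "V \<in> components_of V E"
    using assms by (simp add: connected_graph_iff)
  have "C = V" if "C \<in> components_of V E" for C
    using quotient_disj[OF equiv_reachability, of C V E V] that V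
      component_nonempty[OF that] component_subset[OF that]
    by (auto simp: components_of_def)
  with V show ?thesis by blast
qed

text \<open>The endpoints of an edge reach each other, so no edge joins a component to its
  complement.\<close>

lemma component_edge_split:
  assumes "E \<in> simple_graphs V" "S \<in> components_of V E"
  shows "E = (E \<inter> Pow S) \<union> (E \<inter> Pow (V - S))"
proof -
  have "e \<subseteq> S \<or> e \<subseteq> V - S" if "e \<in> E" for e
  proof -
    from that assms(1) have "card e = 2" "e \<subseteq> V"
      by (auto simp: simple_graphs_def)
    then obtain u v where e: "e = {u, v}"
      by (auto simp: card_2_iff)
    with \<open>e \<subseteq> V\<close> that have "(u, v) \<in> reachability V E"
      by (auto simp: reachability_def)
    then have "u \<in> S \<longleftrightarrow> v \<in> S"
      using assms(2) equiv_reachability[of V E]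
      by (metis components_of_def equivE in_quotient_imp_closed symE)
    with e \<open>e \<subseteq> V\<close> show ?thesis by auto
  qed
  then show ?thesis by blast
qed

section \<open>Transport of graphs along injective maps\<close>

lemma components_of_image:
  assumes "inj_on f V" "E \<in> simple_graphs V"
  shows "components_of (f ` V) ((`) f ` E) = (`) f ` components_of V E"
proof -
  have inv: "inv_into V f ` f ` A = A" if "A \<subseteq> V" for A
    using assms(1) that by (rule inv_into_image_cancel)
  have invE: "(`) (inv_into V f) ` (`) f ` E = E"
    using simple_graphs_subset_Pow[OF assms(2)] by (intro image_image_cancel inv) blast
  \<comment> \<open>Paths map forward under any map; applying this to \<open>inv_into V f\<close>
    brings paths in the image back to \<open>V\<close>.\<close>
  have reflect: "(u, v) \<in> reachability V E"
    if "(f u, f v) \<in> reachability (f ` V) ((`) f ` E)" "u \<in> V" "v \<in> V" for u v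
    using reachability_image[OF that(1), of "inv_into V f"] that(2,3) assms(1)
    unfolding invE inv[OF order_refl] by simp
  have "reachability (f ` V) ((`) f ` E) `` {f u} = f ` (reachability V E `` {u})" if "u \<in> V" for u
  proof (intro equalityI subsetI)
    fix w assume w: "w \<in> reachability (f ` V) ((`) f ` E) `` {f u}"
    then obtain v where "w = f v" "v \<in> V"
      using reachability_subset by blast
    with w reflect that show "w \<in> f ` (reachability V E `` {u})" by auto
  qed (auto intro: reachability_image)
  then show ?thesis
    unfolding components_of_def quotient_def by auto
qed

lemma card_components_of_image:
  assumes "inj_on f V" "E \<in> simple_graphs V"
  shows "card (components_of (f ` V) ((`) f ` E)) = card (components_of V E)"
proof -
  have "inj_on ((`) f) (components_of V E)"
    using component_subset[of _ V E] by (intro inj_on_subset[OF inj_on_image_Pow[OF assms(1)]]) auto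
  then show ?thesis
    by (simp add: components_of_image[OF assms] card_image)
qed

lemma connected_graph_image:
  assumes "connected_graph V E"
  shows "connected_graph (f ` V) ((`) f ` E)"
  using assms reachability_image[of _ _ V E f] unfolding connected_graph_def by blast

lemma card_edges_image:
  assumes "inj_on f V" "E \<in> simple_graphs V"
  shows "card ((`) f ` E) = card E"
  by (rule card_image[OF inj_on_subset[OF inj_on_image_Pow[OF assms(1)] simple_graphs_subset_Pow[OF assms(2)]]])

lemma simple_graphs_image:
  assumes "inj_on f V" "E \<in> simple_graphs V"
  shows "(`) f ` E \<in> simple_graphs (f ` V)"
  using assms(2) by (auto simp: simple_graphs_def card_image[OF inj_on_subset[OF assms(1)]])

lemma bipartite_image:
  assumes "inj_on f V" "E \<in> simple_graphs V" "bipartite V E"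
  shows "bipartite (f ` V) ((`) f ` E)"
proof -
  from assms(3) obtain c :: "'a \<Rightarrow> bool"
    where c: "\<And>u v. u \<in> V \<Longrightarrow> v \<in> V \<Longrightarrow> {u, v} \<in> E \<Longrightarrow> c u \<noteq> c v"
    unfolding bipartite_def by blast
  \<comment> \<open>An image edge on \<open>f u\<close> and \<open>f v\<close> comes from some
    \<open>e \<subseteq> V\<close> with the same image as \<open>{u, v}\<close>; injectivity on
    \<open>V\<close> forces \<open>e = {u, v}\<close>.\<close>
  have "{u, v} \<in> E" if "u \<in> V" "v \<in> V" "{f u, f v} \<in> (`) f ` E" for u v
  proof -
    from that(3) obtain e where e: "e \<in> E" "f ` {u, v} = f ` e"
      by auto
    moreover have "e \<subseteq> V"
      using e simple_graphs_subset_Pow[OF assms(2)] by auto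
    ultimately show ?thesis
      using inj_on_image_eq_iff[OF assms(1), of "{u, v}" e] that by auto
  qed
  with c assms(1) show ?thesis
    unfolding bipartite_def by (intro exI[of _ "c \<circ> inv_into V f"]) auto
qed

section \<open>Bipartiteness of subgraphs and disjoint unions\<close>

lemma bipartite_mono:
  assumes "bipartite W F" "V \<subseteq> W" "E \<subseteq> F"
  shows "bipartite V E"
proof -
  from assms(1) obtain c :: "'a \<Rightarrow> bool" where "\<forall>u\<in>W. \<forall>v\<in>W. {u, v} \<in> F \<longrightarrow> c u \<noteq> c v"
    unfolding bipartite_def by blast
  with assms(2,3) show ?thesis
    unfolding bipartite_def by (intro exI[of _ c]) blast
qed

lemma bipartite_Un:
  assumes "S \<inter> T = {}" "E \<subseteq> Pow S" "F \<subseteq> Pow T" "bipartite S E" "bipartite T F"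
  shows "bipartite (S \<union> T) (E \<union> F)"
proof -
  from assms(4,5) obtain c d :: "'a \<Rightarrow> bool"
    where cd: "\<forall>u\<in>S. \<forall>v\<in>S. {u, v} \<in> E \<longrightarrow> c u \<noteq> c v" "\<forall>u\<in>T. \<forall>v\<in>T. {u, v} \<in> F \<longrightarrow> d u \<noteq> d v"
    unfolding bipartite_def by blast
  have "(if u \<in> S then c u else d u) \<noteq> (if v \<in> S then c v else d v)" if "{u, v} \<in> E \<union> F" for u v
  proof -
    from that assms(2,3) consider "{u, v} \<in> E" "u \<in> S" "v \<in> S" | "{u, v} \<in> F" "u \<in> T" "v \<in> T"
      by blast
    then show ?thesis
      using cd assms(1) by cases auto
  qed
  then show ?thesis
    unfolding bipartite_def by (intro exI[of _ "\<lambda>u. if u \<in> S then c u else d u"]) auto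
qed


section \<open>Generating polynomials in the number of edges\<close>

text \<open>The vertex set is arbitrary because removing a component from \<open>{1..n}\<close>
  rarely leaves an initial interval.\<close>

definition bipartite_graphs :: "'a set \<Rightarrow> nat \<Rightarrow> 'a set set set" where
  "bipartite_graphs V \<nu> = {E \<in> simple_graphs V. bipartite V E \<and> card (components_of V E) = \<nu>}"

definition connected_bipartite_graphs :: "'a set \<Rightarrow> 'a set set set" where
  "connected_bipartite_graphs V = {E \<in> simple_graphs V. connected_graph V E \<and> bipartite V E}"

text \<open>Here \<open>fps_X\<close> is the variable \<open>y\<close>.\<close>

definition edge_gf :: "'a set set set \<Rightarrow> rat fps" where
  "edge_gf A = (\<Sum>E\<in>A. fps_X ^ card E)"

lemma finite_bipartite_graphs: "finite V \<Longrightarrow> finite (bipartite_graphs V \<nu>)"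
  by (simp add: bipartite_graphs_def finite_simple_graphs)

lemma finite_connected_bipartite_graphs: "finite V \<Longrightarrow> finite (connected_bipartite_graphs V)"
  by (simp add: connected_bipartite_graphs_def finite_simple_graphs)

lemma edge_gf_nth: "finite A \<Longrightarrow> fps_nth (edge_gf A) k = of_nat (card {E \<in> A. card E = k})"
  by (auto simp: edge_gf_def fps_sum_nth fps_X_power_nth Int_def sum.If_cases intro!: arg_cong[of _ _ card])

lemma edge_gf_relabel:
  assumes "bij_betw f V W"
    and "A \<subseteq> simple_graphs V" "B \<subseteq> simple_graphs W"
    and "\<And>E. E \<in> A \<Longrightarrow> (`) f ` E \<in> B" "\<And>E. E \<in> B \<Longrightarrow> (`) (inv_into V f) ` E \<in> A"
  shows "edge_gf A = edge_gf B"
  unfolding edge_gf_def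
proof (rule sum.reindex_bij_witness[where i = "\<lambda>E. (`) (inv_into V f) ` E" and j = "\<lambda>E. (`) f ` E"])
  have inj: "inj_on f V"
    using assms(1) by (auto simp: bij_betw_def)
  fix E assume "E \<in> A"
  then have E: "E \<in> simple_graphs V"
    using assms(2) by auto
  show "(`) (inv_into V f) ` (`) f ` E = E"
    using simple_graphs_subset_Pow[OF E]
    by (intro image_image_cancel inv_into_image_cancel[OF inj]) blast
  show "fps_X ^ card ((`) f ` E) = (fps_X ^ card E :: rat fps)"
    by (simp add: card_edges_image[OF inj E])
next
  have W: "f ` V = W"
    using assms(1) by (auto simp: bij_betw_def)
  fix E assume "E \<in> B"
  then have E: "E \<in> simple_graphs W"
    using assms(3) by auto
  show "(`) f ` (`) (inv_into V f) ` E = E"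
    using simple_graphs_subset_Pow[OF E]
    by (intro image_image_cancel image_inv_into_cancel[OF W]) blast
qed (use assms in auto)

text \<open>A bijection of the vertices and its inverse preserve all the defining properties. This
  lets the vertex sets in the recurrence be replaced by initial intervals.\<close>

lemma edge_gf_card_cong:
  assumes "finite V" "finite W" "card V = card W"
  shows "edge_gf (bipartite_graphs V \<nu>) = edge_gf (bipartite_graphs W \<nu>)"
    and "edge_gf (connected_bipartite_graphs V) = edge_gf (connected_bipartite_graphs W)"
proof -
  obtain f where f: "bij_betw f V W"
    using assms finite_same_card_bij by blast
  have 1: "inj_on f V" "f ` V = W"
    using f by (auto simp: bij_betw_def)
  have 2: "inj_on (inv_into V f) W" "inv_into V f ` W = V"
    using bij_betw_inv_into[OF f] by (auto simp: bij_betw_def)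
  note [simp] = bipartite_graphs_def connected_bipartite_graphs_def
  show "edge_gf (bipartite_graphs V \<nu>) = edge_gf (bipartite_graphs W \<nu>)"
    using simple_graphs_image[OF 1(1)] bipartite_image[OF 1(1)] card_components_of_image[OF 1(1)]
      simple_graphs_image[OF 2(1)] bipartite_image[OF 2(1)] card_components_of_image[OF 2(1)]
    by (intro edge_gf_relabel[OF f]) (auto simp: 1(2) 2(2))
  show "edge_gf (connected_bipartite_graphs V) = edge_gf (connected_bipartite_graphs W)"
    using simple_graphs_image[OF 1(1)] bipartite_image[OF 1(1)] connected_graph_image[of V _ f]
      simple_graphs_image[OF 2(1)] bipartite_image[OF 2(1)] connected_graph_image[of W _ "inv_into V f"]
    by (intro edge_gf_relabel[OF f]) (auto simp: 1(2) 2(2))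
qed

section \<open>Marking a component: splitting and gluing\<close>

lemma simple_graphs_restrict:
  "E \<in> simple_graphs V \<Longrightarrow> E \<inter> Pow S \<in> simple_graphs S"
  by (auto simp: simple_graphs_def)

lemma split_off_component:
  assumes fin: "finite V" and E: "E \<in> bipartite_graphs V (Suc \<nu>)" and S: "S \<in> components_of V E"
  shows "E \<inter> Pow S \<in> connected_bipartite_graphs S"
    and "E \<inter> Pow (V - S) \<in> bipartite_graphs (V - S) \<nu>"
proof -
  let ?T = "V - S"
  have simple: "E \<in> simple_graphs V" and bip: "bipartite V E"
    and card: "card (components_of V E) = Suc \<nu>"
    using E by (auto simp: bipartite_graphs_def)
  have "S \<subseteq> V"
    using S by (rule component_subset)
  then have V: "S \<union> ?T = V" by auto
  have comps: "components_of V E = components_of S (E \<inter> Pow S) \<union> components_of ?T (E \<inter> Pow ?T)"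
    using components_of_Un[of S ?T "E \<inter> Pow S" "E \<inter> Pow ?T"]
      component_edge_split[OF simple S] V by simp
  \<comment> \<open>Components of the rest lie in \<open>V - S\<close>, whereas \<open>S\<close> is
    nonempty. So \<open>S\<close> must be a component of the part inside \<open>S\<close>, which
    makes that part connected with \<open>S\<close> as its only component.\<close>
  have notin: "S \<notin> components_of ?T (E \<inter> Pow ?T)"
    using component_subset[of S ?T] component_nonempty[OF S] by auto
  with comps S have conn: "connected_graph S (E \<inter> Pow S)"
    by (auto simp: connected_graph_iff)
  then have "components_of V E = insert S (components_of ?T (E \<inter> Pow ?T))"
    using comps components_of_connected by auto
  with card notin have "card (components_of ?T (E \<inter> Pow ?T)) = \<nu>"
    using fin by (simp add: finite_components_of)
  then show "E \<inter> Pow ?T \<in> bipartite_graphs ?T \<nu>"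
    using simple bip
    by (auto simp: bipartite_graphs_def intro: simple_graphs_restrict bipartite_mono)
  show "E \<inter> Pow S \<in> connected_bipartite_graphs S"
    using simple bip conn \<open>S \<subseteq> V\<close>
    by (auto simp: connected_bipartite_graphs_def intro: simple_graphs_restrict bipartite_mono)
qed

text \<open>The inverse of \<open>split_off_component\<close>: intersecting with
  \<open>Pow S\<close> and \<open>Pow (V - S)\<close> recovers both pieces.\<close>

lemma attach_component:
  assumes fin: "finite V" and "S \<subseteq> V"
    and E: "E \<in> connected_bipartite_graphs S" and F: "F \<in> bipartite_graphs (V - S) \<nu>"
  shows "E \<union> F \<in> bipartite_graphs V (Suc \<nu>)" "S \<in> components_of V (E \<union> F)"
    and "(E \<union> F) \<inter> Pow S = E" "(E \<union> F) \<inter> Pow (V - S) = F" "card (E \<union> F) = card E + card F"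
proof -
  let ?T = "V - S"
  have V: "S \<union> ?T = V"
    using \<open>S \<subseteq> V\<close> by auto
  have E': "E \<in> simple_graphs S" "connected_graph S E" "bipartite S E"
    using E by (auto simp: connected_bipartite_graphs_def)
  have F': "F \<in> simple_graphs ?T" "bipartite ?T F" "card (components_of ?T F) = \<nu>"
    using F by (auto simp: bipartite_graphs_def)
  note sub = simple_graphs_subset_Pow[OF E'(1)] simple_graphs_subset_Pow[OF F'(1)]
  \<comment> \<open>Only the empty set lies inside both \<open>S\<close> and \<open>V - S\<close>.
    Edges have two elements, so the two edge sets cannot overlap.\<close>
  have "{} \<notin> E" "{} \<notin> F"
    using E'(1) F'(1) by (auto simp: simple_graphs_def)
  have empty: "e = {}" if "e \<subseteq> S" "e \<subseteq> ?T" for e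
    using that by auto
  have "\<not> e \<subseteq> ?T" if "e \<in> E" for e
    using that empty[of e] sub(1) \<open>{} \<notin> E\<close> by auto
  moreover have "\<not> e \<subseteq> S" if "e \<in> F" for e
    using that empty[of e] sub(2) \<open>{} \<notin> F\<close> by auto
  ultimately have dis: "E \<inter> Pow ?T = {}" "F \<inter> Pow S = {}"
    by blast+
  then show "(E \<union> F) \<inter> Pow S = E" "(E \<union> F) \<inter> Pow ?T = F"
    using sub by blast+
  have "E \<inter> F = {}"
    using dis sub by blast
  then show "card (E \<union> F) = card E + card F"
    using fin \<open>S \<subseteq> V\<close> E' F' by (intro card_Un_disjoint) (auto intro: finite_edges finite_subset)
  have comps: "components_of V (E \<union> F) = insert S (components_of ?T F)"
    using components_of_Un[OF _ sub] V components_of_connected[OF E'(2)] by simp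
  then show "S \<in> components_of V (E \<union> F)" by simp
  have "S \<noteq> {}"
    using E'(2) by (simp add: connected_graph_def)
  then have "S \<notin> components_of ?T F"
    using component_subset[of S ?T] by auto
  then have "card (components_of V (E \<union> F)) = Suc \<nu>"
    using comps F'(3) fin by (simp add: finite_components_of)
  moreover have "bipartite V (E \<union> F)"
    using bipartite_Un[OF _ sub E'(3) F'(2)] V by simp
  moreover have "E \<union> F \<in> simple_graphs V"
    using E'(1) F'(1) \<open>S \<subseteq> V\<close> by (auto simp: simple_graphs_def)
  ultimately show "E \<union> F \<in> bipartite_graphs V (Suc \<nu>)"
    by (simp add: bipartite_graphs_def)
qed

lemma edge_gf_bipartite_Suc:
  assumes "finite V"
  shows "of_nat (Suc \<nu>) * edge_gf (bipartite_graphs V (Suc \<nu>)) =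
    (\<Sum>S\<in>Pow V. edge_gf (connected_bipartite_graphs S) * edge_gf (bipartite_graphs (V - S) \<nu>))"
proof -
  let ?B = "bipartite_graphs V (Suc \<nu>)"
  let ?split = "\<lambda>(E, S). (S, E \<inter> Pow S, E \<inter> Pow (V - S))"
  let ?glue = "\<lambda>(S, E, F). (E \<union> F, S)"
  \<comment> \<open>The choice \<open>S = {}\<close> contributes no triple, since connected graphs
    are nonempty.\<close>
  let ?D = "SIGMA S:Pow V. connected_bipartite_graphs S \<times> bipartite_graphs (V - S) \<nu>"
  have fin: "finite (connected_bipartite_graphs S \<times> bipartite_graphs (V - S) \<nu>)" if "S \<subseteq> V" for S
    using assms that finite_subset
    by (blast intro: finite_connected_bipartite_graphs finite_bipartite_graphs)
  \<comment> \<open>The factor \<open>Suc \<nu>\<close> counts the ways to mark a component, as each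
    graph in \<open>?B\<close> has exactly that many.\<close>
  have "of_nat (Suc \<nu>) * edge_gf ?B = (\<Sum>E\<in>?B. \<Sum>S\<in>components_of V E. fps_X ^ card E)"
    by (simp add: edge_gf_def sum_distrib_left bipartite_graphs_def)
  also have "\<dots> = (\<Sum>(E, S)\<in>Sigma ?B (components_of V). fps_X ^ card E)"
    using assms by (subst sum.Sigma) (auto simp: finite_bipartite_graphs finite_components_of)
  \<comment> \<open>Graphs with a marked component correspond bijectively to triples of a vertex
    set, a connected graph on it and a graph on the rest; edge counts add.\<close>
  also have "\<dots> = (\<Sum>(S, E, F)\<in>?D. fps_X ^ card E * fps_X ^ card F)"
  proof (rule sum.reindex_bij_witness[where i = ?glue and j = ?split])
    fix a assume "a \<in> Sigma ?B (components_of V)"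
    then obtain E S where a: "a = (E, S)" and E: "E \<in> ?B" and S: "S \<in> components_of V E"
      by auto
    note parts = split_off_component[OF assms E S]
    have eq: "E \<inter> Pow S \<union> E \<inter> Pow (V - S) = E"
      using component_edge_split[OF _ S] E by (auto simp: bipartite_graphs_def)
    show "?glue (?split a) = a"
      using eq a by simp
    show "?split a \<in> ?D"
      using parts a component_subset[OF S] by auto
    have "card E = card (E \<inter> Pow S) + card (E \<inter> Pow (V - S))"
      using attach_component(5)[OF assms component_subset[OF S] parts] eq by simp
    then show "(\<lambda>(S, E, F). fps_X ^ card E * fps_X ^ card F) (?split a) =
        ((\<lambda>(E, S). fps_X ^ card E) a :: rat fps)"
      using a by (simp add: power_add)
  next
    fix b assume "b \<in> ?D"
    then obtain S E F where b: "b = (S, E, F)" and "S \<subseteq> V"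
      "E \<in> connected_bipartite_graphs S" "F \<in> bipartite_graphs (V - S) \<nu>"
      by auto
    note glued = attach_component[OF assms this(2-4)]
    show "?split (?glue b) = b"
      using glued(3,4) b by simp
    show "?glue b \<in> Sigma ?B (components_of V)"
      using glued(1,2) b by simp
  qed
  also have "\<dots> = (\<Sum>S\<in>Pow V. \<Sum>(E, F)\<in>connected_bipartite_graphs S \<times> bipartite_graphs (V - S) \<nu>.
      fps_X ^ card E * fps_X ^ card F)"
    using assms fin by (subst sum.Sigma) auto
  also have "\<dots> = (\<Sum>S\<in>Pow V. edge_gf (connected_bipartite_graphs S) * edge_gf (bipartite_graphs (V - S) \<nu>))"
    by (simp add: edge_gf_def sum_product sum.cartesian_product)
  finally show ?thesis .
qed

section \<open>The recurrence on initial intervals\<close>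

definition bipartite_gf :: "nat \<Rightarrow> nat \<Rightarrow> rat fps" where
  "bipartite_gf \<nu> n = edge_gf (bipartite_graphs {1..n} \<nu>)"

definition connected_gf :: "nat \<Rightarrow> rat fps" where
  "connected_gf n = edge_gf (connected_bipartite_graphs {1..n})"

lemma bipartite_gf_nth: "fps_nth (bipartite_gf \<nu> n) k = of_nat (num_bipartite n k \<nu>)"
  unfolding bipartite_gf_def edge_gf_nth[OF finite_bipartite_graphs[OF finite_atLeastAtMost]]
  unfolding num_bipartite_def bipartite_graphs_def
  by (intro arg_cong[of _ _ "\<lambda>A. of_nat (card A)"]) auto

lemma connected_gf_nth: "fps_nth (connected_gf n) k = of_nat (num_connected_bipartite n k)"
  unfolding connected_gf_def
    edge_gf_nth[OF finite_connected_bipartite_graphs[OF finite_atLeastAtMost]]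
  unfolding num_connected_bipartite_def connected_bipartite_graphs_def
  by (intro arg_cong[of _ _ "\<lambda>A. of_nat (card A)"]) auto

lemma connected_gf_0: "connected_gf 0 = 0"
  by (simp add: connected_gf_def edge_gf_def connected_bipartite_graphs_def connected_graph_def)

text \<open>Any vertex lies in a component, so only the graph without vertices has none. It yields
  the constant term 1 and starts the induction on \<open>\<nu>\<close>.\<close>

lemma bipartite_gf_0: "bipartite_gf 0 n = (if n = 0 then 1 else 0)"
proof (cases "n = 0")
  case True
  have "bipartite_graphs {1..n} 0 = {{}}"
    using True by (auto simp: bipartite_graphs_def simple_graphs_def bipartite_def
        components_of_def quotient_def)
  then show ?thesis
    using True by (simp add: bipartite_gf_def edge_gf_def)
next
  case False
  have "components_of {1..n} E \<noteq> {}" for E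
    using False by (auto simp: components_of_def quotient_def)
  then have "bipartite_graphs {1..n} 0 = {}"
    by (auto simp: bipartite_graphs_def finite_components_of)
  then show ?thesis
    using False by (simp add: bipartite_gf_def edge_gf_def)
qed

lemma sum_Pow_card:
  fixes g :: "nat \<Rightarrow> 'b::comm_semiring_1"
  assumes "finite V"
  shows "(\<Sum>S\<in>Pow V. g (card S)) = (\<Sum>j=0..card V. of_nat (card V choose j) * g j)"
proof -
  have "(\<Sum>S\<in>Pow V. g (card S)) = (\<Sum>j\<in>{0..card V}. \<Sum>S | S \<in> Pow V \<and> card S = j. g (card S))"
    using assms by (intro sum.group[symmetric]) (auto intro: card_mono)
  also have "\<dots> = (\<Sum>j\<in>{0..card V}. of_nat (card V choose j) * g j)"
    using assms by (intro sum.cong) (simp_all add: n_subsets)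
  finally show ?thesis .
qed

text \<open>The binomial coefficient counts the vertex sets of size \<open>j\<close> available to
  the marked component.\<close>

lemma bipartite_gf_Suc:
  "of_nat (Suc \<nu>) * bipartite_gf (Suc \<nu>) n =
    (\<Sum>j=0..n. of_nat (n choose j) * (connected_gf j * bipartite_gf \<nu> (n - j)))"
proof -
  have "of_nat (Suc \<nu>) * bipartite_gf (Suc \<nu>) n =
      (\<Sum>S\<in>Pow {1..n}. connected_gf (card S) * bipartite_gf \<nu> (n - card S))"
    unfolding bipartite_gf_def edge_gf_bipartite_Suc[OF finite_atLeastAtMost] connected_gf_def
    by (intro sum.cong refl arg_cong2[of _ _ _ _ "(*)"] edge_gf_card_cong)
      (auto intro: finite_subset simp: card_Diff_subset finite_subset[OF _ finite_atLeastAtMost])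
  also have "\<dots> = (\<Sum>j=0..n. of_nat (n choose j) * (connected_gf j * bipartite_gf \<nu> (n - j)))"
    using sum_Pow_card[of "{1..n}" "\<lambda>j. connected_gf j * bipartite_gf \<nu> (n - j)"] by simp
  finally show ?thesis .
qed


section \<open>Powers of the exponential generating function\<close>

text \<open>This is \<open>B_series\<close> with every \<open>z_n\<close> set to 1.\<close>

definition connected_egf :: "rat fps fps" where
  "connected_egf = Abs_fps (\<lambda>n. fps_const (1 / fact n) * connected_gf n)"

text \<open>The power counts sequences of \<open>\<nu>\<close> components, so each graph appears in
  \<open>fact \<nu>\<close> orders. In the induction, the factorials turn the Cauchy product into
  the binomial convolution of \<open>bipartite_gf_Suc\<close>.\<close>

lemma connected_egf_power_nth:
  "fps_nth (connected_egf ^ \<nu>) n = fps_const (fact \<nu> / fact n) * bipartite_gf \<nu> n"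
proof (induction \<nu> arbitrary: n)
  case 0
  show ?case by (simp add: bipartite_gf_0)
next
  case (Suc \<nu>)
  have "fps_nth (connected_egf ^ Suc \<nu>) n =
      (\<Sum>j=0..n. fps_const (1 / fact j) * connected_gf j *
        (fps_const (fact \<nu> / fact (n - j)) * bipartite_gf \<nu> (n - j)))"
    by (simp add: fps_mult_nth Suc.IH) (simp add: connected_egf_def)
  also have "\<dots> = (\<Sum>j=0..n. fps_const (fact \<nu> / fact n) *
        (of_nat (n choose j) * (connected_gf j * bipartite_gf \<nu> (n - j))))"
  proof (intro sum.cong refl)
    fix j assume "j \<in> {0..n}"
    then have "(1 / fact j) * (fact \<nu> / fact (n - j)) = (fact \<nu> / fact n) * (of_nat (n choose j) :: rat)"
      by (simp add: binomial_fact)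
    then have "fps_const (1 / fact j) * fps_const (fact \<nu> / fact (n - j)) =
        fps_const (fact \<nu> / fact n) * (of_nat (n choose j) :: rat fps)"
      by (simp flip: fps_of_nat)
    then show "fps_const (1 / fact j) * connected_gf j *
        (fps_const (fact \<nu> / fact (n - j)) * bipartite_gf \<nu> (n - j)) =
        fps_const (fact \<nu> / fact n) *
        (of_nat (n choose j) * (connected_gf j * bipartite_gf \<nu> (n - j)))"
      by (metis (no_types, lifting) mult.assoc mult.left_commute)
  qed
  also have "\<dots> = fps_const (fact \<nu> / fact n) * (of_nat (Suc \<nu>) * bipartite_gf (Suc \<nu>) n)"
    by (simp only: bipartite_gf_Suc sum_distrib_left)
  also have "\<dots> = fps_const (fact (Suc \<nu>) / fact n) * bipartite_gf (Suc \<nu>) n"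
  proof -
    have "fps_const (fact \<nu> / fact n) * (of_nat (Suc \<nu>) :: rat fps) = fps_const (fact (Suc \<nu>) / fact n)"
      unfolding fps_of_nat[symmetric] fps_const_mult by (simp add: algebra_simps)
    then show ?thesis by (metis mult.assoc)
  qed
  finally show ?case .
qed

section \<open>Collapsing the variables \<open>z_i\<close> into \<open>z\<close>\<close>

lemma tau_coeff_B_series_nth:
  "tau_coeff (\<lambda>_. 1) (fps_nth B_series n) = Poly_Mapping.single 1 (fps_nth connected_egf n)"
proof (cases "n = 0")
  case True
  then show ?thesis
    \<comment> \<open>At \<open>n = 0\<close> both sides vanish: \<open>B_series\<close> by its
      definition, \<open>connected_egf\<close> because the graph without vertices is not
      connected.\<close>
    by (simp add: B_series_def connected_egf_def connected_gf_0 tau_coeff_zero)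
next
  case False
  have "Abs_fps (\<lambda>k. of_nat (num_connected_bipartite n k) / fact n) =
      fps_const (1 / fact n) * connected_gf n"
    by (rule fps_ext) (simp add: connected_gf_nth)
  with False show ?thesis
    by (simp add: B_series_def connected_egf_def tau_coeff_single)
qed

lemma single_sum: "Poly_Mapping.single a (\<Sum>i\<in>I. f i) = (\<Sum>i\<in>I. Poly_Mapping.single a (f i))"
  by (induction I rule: infinite_finite_induct) (auto simp: single_add)

text \<open>Each term of \<open>B_series\<close> contains one variable \<open>z_n\<close>, to the
  first power, so all terms of the \<open>m\<close>-th power have total degree \<open>m\<close> in
  these variables and collapse to the same power of \<open>z\<close>.\<close>

lemma tau_coeff_B_series_power_nth:
  "tau_coeff (\<lambda>_. 1) (fps_nth (B_series ^ m) n) =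
    Poly_Mapping.single (of_nat m) (fps_nth (connected_egf ^ m) n)"
proof (induction m arbitrary: n)
  case 0
  show ?case by (simp add: tau_coeff_one tau_coeff_zero)
next
  case (Suc m)
  show ?case
    by (simp add: fps_mult_nth tau_coeff_sum tau_coeff_mult Suc.IH tau_coeff_B_series_nth
        mult_single single_sum)
qed

text \<open>The \<open>1 / fact m\<close> of the exponential cancels the \<open>fact m\<close>
  orderings of the components. Composition truncates the sum at \<open>n\<close>, which is faithful
  as \<open>B_series\<close> has no constant term.\<close>

lemma tau_exp_B_series_nth:
  "fps_nth (tau (\<lambda>_. 1) (exp_series B_series)) n =
    (\<Sum>m=0..n. Poly_Mapping.single (of_nat m) (fps_const (1 / fact n) * bipartite_gf m n))"
proof -
  have eq: "fps_const (1 / fact m) * (fps_const (fact m / fact n) * bipartite_gf m n) =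
      fps_const (1 / fact n) * bipartite_gf m n" for m
    by (simp add: mult.assoc[symmetric])
  have "fps_nth (tau (\<lambda>_. 1) (exp_series B_series)) n =
      (\<Sum>m=0..n. Poly_Mapping.single (of_nat m)
        (fps_const (1 / fact m) * (fps_const (fact m / fact n) * bipartite_gf m n)))"
    by (simp add: tau_def exp_series_def fps_compose_nth tau_coeff_sum tau_coeff_mult
        tau_coeff_single tau_coeff_B_series_power_nth connected_egf_power_nth mult_single)
  then show ?thesis
    by (simp only: eq)
qed

text \<open>Every component is the class of some vertex. This covers the values
  \<open>\<nu> > n\<close>, which lie beyond the range of the coefficient sum.\<close>

lemma num_bipartite_eq_0:
  assumes "n < \<nu>"
  shows "num_bipartite n k \<nu> = 0"
proof -
  have "components_of {1..n} E = (\<lambda>u. reachability {1..n} E `` {u}) ` {1..n}" for E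
    by (auto simp: components_of_def quotient_def)
  then have "card (components_of {1..n} E) \<le> n" for E
    using card_image_le[of "{1..n}" "\<lambda>u. reachability {1..n} E `` {u}"] by simp
  then have "card (components_of {1..n} E) \<noteq> \<nu>" for E
    using assms by (metis leD)
  then show ?thesis by (simp add: num_bipartite_def)
qed

text \<open>Division by the nonzero \<open>fact n\<close> can be undone.\<close>

lemma has_expansion_unique: "has_expansion F b \<Longrightarrow> has_expansion F c \<Longrightarrow> b n k \<nu> = c n k \<nu>"
  by (simp add: has_expansion_def)

theorem corollary2:
  shows "has_expansion (tau (\<lambda>_. 1) (exp_series B_series))
           (\<lambda>n k \<nu>. of_nat (num_bipartite n k \<nu>)) \<and>
         (\<forall>b. has_expansion (tau (\<lambda>_. 1) (exp_series B_series)) b \<longrightarrow>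
           (\<forall>n k \<nu>. b n k \<nu> = of_nat (num_bipartite n k \<nu>)))"
proof -
  let ?F = "tau (\<lambda>_. 1) (exp_series B_series)"
  have expansion: "has_expansion ?F (\<lambda>n k \<nu>. of_nat (num_bipartite n k \<nu>))"
    unfolding has_expansion_def
  proof (intro conjI allI impI)
    fix n k \<nu>
    \<comment> \<open>Distinct naturals stay distinct as rational exponents, so only the summand
      \<open>m = \<nu>\<close> can contribute.\<close>
    have "xyz_coeff ?F n k (of_nat \<nu>) =
        (\<Sum>m=0..n. if m = \<nu> then of_nat (num_bipartite n k m) / fact n else 0)"
      by (auto simp: xyz_coeff_def tau_exp_B_series_nth lookup_sum lookup_single when_def
          fps_sum_nth bipartite_gf_nth intro!: sum.cong)
    then show "xyz_coeff ?F n k (of_nat \<nu>) = of_nat (num_bipartite n k \<nu>) / fact n"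
      by (simp add: num_bipartite_eq_0)
  next
    fix n k :: nat and q :: rat assume "q \<notin> \<nat>"
    \<comment> \<open>Every exponent of \<open>z\<close> in the coefficient sum is some
      \<open>of_nat m\<close>.\<close>
    then show "xyz_coeff ?F n k q = 0"
      by (auto simp: xyz_coeff_def tau_exp_B_series_nth lookup_sum lookup_single when_def fps_sum_nth
          intro!: sum.neutral)
  qed
  show ?thesis
    by (intro conjI allI impI) (rule expansion, rule has_expansion_unique[OF _ expansion])
qed

end
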